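(* Let $k\ge 2$, let $0=r_0<r_1<\dots<r_k$ be integers, $d=\gcd(r_1,\dots,r_k)$, and let $n$ be a positive integer with $\gcd(n,d)=1$ and $n>N$, where $N$ is the integer associated with $M_n=\langle n,n+r_1,\dots,n+r_k\rangle$ defined in the context. If $M_n$ is almost symmetric, then $M_{n+\lambda r_k}$ is almost symmetric for every $\lambda\in\mathbb{N}$.
   Context: $\mathbb{N}$ includes $0$, and $\langle a_1,\dots,a_s\rangle=\{\sum\lambda_i a_i\mid\lambda_i\in\mathbb{N}\}$. For a numerical semigroup $H$ (additive submonoid of $\mathbb{N}$ with finite complement), $\operatorname{F}(H)=\max(\mathbb{Z}\setminus H)$, $\operatorname{PF}(H)=\{x\in\mathbb{Z}\setminus H\mid x+h\in H\ \forall\, 0\neq h\in H\}$, $K(H)=\{x\in\mathbb{N}\mid\operatorname{F}(H)-x\notin H\}$ and $M(H)=H\setminus\{0\}$. $H$ is almost symmetric if $M(H)+K(H)\subseteq M(H)$. Notation: $S=\langle r_1,\dots,r_k\rangle$; $\operatorname{F}(S)=\max\{s\in\mathbb{Z}\setminus S\mid s\equiv0\bmod d\}$ (possibly negative); $N_0=\max\{r_k^2,r_k^2+\operatorname{F}(S)r_k\}$; for $i\in S$, $\mathbf{m}(i)$ is the minimum of $\lambda_1+\dots+\lambda_k$ over all expressions $i=\lambda_1r_1+\dots+\lambda_kr_k$ with $\lambda_j\in\mathbb{N}$; $\operatorname{Ap}(S,dn)=\{s\in S\mid s-dn\notin S\}$; for $n>N_0$, $P_n=\{i\in\operatorname{Ap}(S,dn)\mid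 f\equiv i\bmod n\text{ for some }f\in\operatorname{PF}(M_n)\}$, $P_n'=\{i\in P_n\mid i<dn-r_k\}$, $P_n''=\{i\in P_n\mid i\ge dn-r_k\}$. Definition of $N$ (for $M_n$ with $n>N_0$): $N_1=\max\{0,\ r_k+\ell-i,\ (\mathbf{m}(\ell)-\mathbf{m}(i))r_k-\ell+i \mid i,\ell\in P_n'\}$, $N_2=\max\{0,\ (\mathbf{m}(\ell)-\mathbf{m}(i))r_k-\ell+i\mid i,\ell\in P_n''\}$, $N_3=\max\{0,\ (\mathbf{m}(\ell)r_k+3r_k)/d\mid \ell\in P_n'\}$, $N=\max\{N_0+r_k+\operatorname{F}(S)/d,\ N_1,N_2,N_3\}$. The hypothesis $n>N$ includes $n>N_0$. *)

theory Defs
  imports "HOL-Number_Theory.Cong"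
begin

definition semigroup_gen :: "nat set \<Rightarrow> (nat \<Rightarrow> int) \<Rightarrow> int set" where
  "semigroup_gen I a = {(\<Sum>j\<in>I. int (c j) * a j) | c :: nat \<Rightarrow> nat. True}"

definition numerical_semigroup :: "int set \<Rightarrow> bool" where
  "numerical_semigroup H \<longleftrightarrow>
     H \<subseteq> {0..} \<and> 0 \<in> H \<and> (\<forall>x\<in>H. \<forall>y\<in>H. x + y \<in> H) \<and> finite ({0..} - H)"

text \<open>The gaps range over all integers (so the Frobenius number of the full semigroup of
  naturals is -1). This set is infinite, hence GREATEST instead of Max.\<close>
definition Frobenius :: "int set \<Rightarrow> int" where
  "Frobenius H = (GREATEST x. x \<notin> H)"

definition pseudo_Frobenius :: "int set \<Rightarrow> int set" where
  "pseudo_Frobenius H = {x. x \<notin> H \<and> (\<forall>h\<in>H. h \<noteq> 0 \<longrightarrow> x + h \<in> H)}"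

definition canonical_ideal :: "int set \<Rightarrow> int set" where
  "canonical_ideal H = {x. 0 \<le> x \<and> Frobenius H - x \<notin> H}"

definition maximal_ideal :: "int set \<Rightarrow> int set" where
  "maximal_ideal H = H - {0}"

definition almost_symmetric :: "int set \<Rightarrow> bool" where
  "almost_symmetric H \<longleftrightarrow> numerical_semigroup H \<and>
     {x + y | x y. x \<in> maximal_ideal H \<and> y \<in> canonical_ideal H} \<subseteq> maximal_ideal H"

definition Apery :: "int set \<Rightarrow> int \<Rightarrow> int set" where
  "Apery H m = {s \<in> H. s - m \<notin> H}"

text \<open>The parameters \<open>r\<close> and \<open>k\<close> below encode a sequence \<open>0 = r 0 < r 1 < \<dots> < r k\<close>.\<close>

definition shifted_semigroup :: "(nat \<Rightarrow> int) \<Rightarrow> nat \<Rightarrow> int \<Rightarrow> int set" where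
  "shifted_semigroup r k n = semigroup_gen {0..k} (\<lambda>j. n + r j)"

definition S_of :: "(nat \<Rightarrow> int) \<Rightarrow> nat \<Rightarrow> int set" where
  "S_of r k = semigroup_gen {1..k} r"

definition d_of :: "(nat \<Rightarrow> int) \<Rightarrow> nat \<Rightarrow> int" where
  "d_of r k = Gcd (r ` {1..k})"

text \<open>Unlike \<open>Frobenius\<close>, only gaps divisible by \<open>d\<close> count; the value may be negative.\<close>
definition F_S :: "(nat \<Rightarrow> int) \<Rightarrow> nat \<Rightarrow> int" where
  "F_S r k = (GREATEST s. s \<notin> S_of r k \<and> [s = 0] (mod d_of r k))"

definition N0 :: "(nat \<Rightarrow> int) \<Rightarrow> nat \<Rightarrow> int" where
  "N0 r k = max ((r k)\<^sup>2) ((r k)\<^sup>2 + F_S r k * r k)"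

definition min_length :: "(nat \<Rightarrow> int) \<Rightarrow> nat \<Rightarrow> int \<Rightarrow> int" where
  "min_length r k i = int (LEAST m. \<exists>c :: nat \<Rightarrow> nat.
     i = (\<Sum>j\<in>{1..k}. int (c j) * r j) \<and> m = (\<Sum>j\<in>{1..k}. c j))"

definition P_set :: "(nat \<Rightarrow> int) \<Rightarrow> nat \<Rightarrow> int \<Rightarrow> int set" where
  "P_set r k n = {i \<in> Apery (S_of r k) (d_of r k * n).
     \<exists>f \<in> pseudo_Frobenius (shifted_semigroup r k n). [f = i] (mod n)}"

definition P_set' :: "(nat \<Rightarrow> int) \<Rightarrow> nat \<Rightarrow> int \<Rightarrow> int set" where
  "P_set' r k n = {i \<in> P_set r k n. i < d_of r k * n - r k}"

definition P_set'' :: "(nat \<Rightarrow> int) \<Rightarrow> nat \<Rightarrow> int \<Rightarrow> int set" where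
  "P_set'' r k n = {i \<in> P_set r k n. i \<ge> d_of r k * n - r k}"

text \<open>The sets under Max are finite because the Apery set of \<open>S\<close> is finite. The divisions by
  \<open>d\<close> are exact because \<open>d\<close> divides both \<open>r k\<close> and \<open>F_S r k\<close>.\<close>

definition N1 :: "(nat \<Rightarrow> int) \<Rightarrow> nat \<Rightarrow> int \<Rightarrow> int" where
  "N1 r k n = Max ({0}
     \<union> {r k + l - i | i l. i \<in> P_set' r k n \<and> l \<in> P_set' r k n}
     \<union> {(min_length r k l - min_length r k i) * r k - l + i | i l.
          i \<in> P_set' r k n \<and> l \<in> P_set' r k n})"

definition N2 :: "(nat \<Rightarrow> int) \<Rightarrow> nat \<Rightarrow> int \<Rightarrow> int" where
  "N2 r k n = Max ({0}
     \<union> {(min_length r k l - min_length r k i) * r k - l + i | i l.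
          i \<in> P_set'' r k n \<and> l \<in> P_set'' r k n})"

definition N3 :: "(nat \<Rightarrow> int) \<Rightarrow> nat \<Rightarrow> int \<Rightarrow> int" where
  "N3 r k n = Max ({0}
     \<union> {(min_length r k l * r k + 3 * r k) div d_of r k | l. l \<in> P_set' r k n})"

definition N_bound :: "(nat \<Rightarrow> int) \<Rightarrow> nat \<Rightarrow> int \<Rightarrow> int" where
  "N_bound r k n =
     Max {N0 r k + r k + F_S r k div d_of r k, N1 r k n, N2 r k n, N3 r k n}"

end

theory Submission imports Defs begin

text \<open>
  Write \<open>R\<close> for the largest entry \<open>r k\<close>, \<open>S\<close> for the semigroup generated by \<open>r 1, \<dots>, r k\<close>,
  \<open>len i\<close> for the least number of generators that sum to \<open>i \<in> S\<close>, and \<open>D = d * n\<close>.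
  A sum of \<open>t\<close> generators of \<open>M n\<close> is \<open>i + t * n\<close>, where \<open>i \<in> S\<close> is a sum of at most \<open>t\<close>
  generators of \<open>S\<close>. So \<open>M n\<close> is governed by \<open>S\<close> and the function \<open>len\<close>, neither of which
  depends on \<open>n\<close>.

  A shortest factorization contains fewer than \<open>R\<close> generators other than \<open>R\<close>, because \<open>R\<close> of
  them contain a nonempty subfamily with sum divisible by \<open>R\<close>, which fewer copies of \<open>R\<close> can
  replace. Hence \<open>len i\<close> is \<open>i / R\<close> up to an error below \<open>R\<close>, and \<open>len (i + R) = len i + 1\<close> once
  \<open>i\<close> is at least \<open>R * R - R\<close>. By the first fact, for \<open>n > R * R\<close> every integer is \<open>i + t * n\<close>
  with a unique \<open>i\<close> in the Apery set of \<open>S\<close> with respect to \<open>D\<close>, and it belongs to \<open>M n\<close>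
  exactly when \<open>len i \<le> t\<close>. So every pseudo-Frobenius number of \<open>M n\<close> has the form
  \<open>i + (len i - 1) * n\<close>, and adding generators shows for which \<open>i\<close> this is one
  (\<open>pseudo_Frobenius_M\<close>). By the second fact these indices split into two groups: the low ones,
  below \<open>R * R\<close>, whose description does not mention \<open>n\<close>, and the high ones, at least \<open>D - R\<close>,
  which move up by \<open>lam * d * R\<close>, while their length grows by \<open>lam * d\<close>, when \<open>n\<close> grows by
  \<open>lam * R\<close> (\<open>pf_indices_below_iff\<close>, \<open>pf_indices_high_shift\<close>).

  Almost symmetry means that \<open>f \<mapsto> F - f\<close> maps the pseudo-Frobenius numbers other than the
  Frobenius number \<open>F\<close> to pseudo-Frobenius numbers. The Frobenius number has a high index \<open>e\<close>. A
  relation \<open>f + g = F\<close> between pseudo-Frobenius numbers with indices \<open>i\<close> and \<open>j\<close> is a congruence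
  modulo \<open>D\<close> for \<open>i + j - e\<close>, and size estimates leave one possibility (\<open>pf_value_pair\<close>): one of
  \<open>i\<close>, \<open>j\<close> is low, the other is high, \<open>i + j = e\<close> and \<open>len i + len j = len e + 1\<close>. With exactly one
  high index on either side, these equations survive the shift of the high indices and of their
  lengths. So the pairing of the pseudo-Frobenius numbers of \<open>M n\<close> carries over to
  \<open>M (n + lam * R)\<close>.
\<close>

section \<open>Pseudo-Frobenius numbers and almost symmetry\<close>

text \<open>Both kinds of Frobenius number are given by \<open>GREATEST\<close> over an infinite set of integers. Only
  finitely many elements lie above a given one, and the largest of these is the value.\<close>
lemma Greatest_int:
  fixes P :: "int \<Rightarrow> bool"
  assumes "P a" and "\<And>x. P x \<Longrightarrow> x \<le> b"
  shows "P (Greatest P)" and "\<And>x. P x \<Longrightarrow> x \<le> Greatest P"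
proof -
  define A where "A = {x. P x \<and> a \<le> x}"
  have fin: "finite A"
    by (rule finite_subset[of _ "{a..b}"]) (auto simp: A_def assms(2))
  have "a \<in> A" using assms(1) by (simp add: A_def)
  then have mem: "Max A \<in> A" using fin Max_in by blast
  have ge: "x \<le> Max A" if "P x" for x
  proof (cases "a \<le> x")
    case True
    then show ?thesis using that fin by (simp add: A_def)
  next
    case False
    then show ?thesis using mem by (simp add: A_def)
  qed
  have "Greatest P = Max A"
    using mem ge by (intro Greatest_equality) (auto simp: A_def)
  then show "P (Greatest P)" "\<And>x. P x \<Longrightarrow> x \<le> Greatest P"
    using mem ge by (auto simp: A_def)
qed

lemma Frobenius_greatest:
  assumes "numerical_semigroup H"
  shows "Frobenius H \<notin> H" and "\<And>x. x \<notin> H \<Longrightarrow> x \<le> Frobenius H"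
proof -
  have fin: "finite (insert 0 ({0..} - H))"
    using assms by (simp add: numerical_semigroup_def)
  have neg: "-1 \<notin> H" using assms by (auto simp: numerical_semigroup_def)
  have bound: "x \<le> Max (insert 0 ({0..} - H))" if "x \<notin> H" for x
  proof (cases "0 \<le> x")
    case True
    then show ?thesis using fin that by (intro Max_ge) auto
  next
    case False
    then show ?thesis using Max_ge[OF fin, of 0] by simp
  qed
  show "Frobenius H \<notin> H" "\<And>x. x \<notin> H \<Longrightarrow> x \<le> Frobenius H"
    unfolding Frobenius_def using Greatest_int[of "\<lambda>x. x \<notin> H", OF neg bound] by auto
qed

lemma Frobenius_in_pseudo_Frobenius:
  assumes "numerical_semigroup H"
  shows "Frobenius H \<in> pseudo_Frobenius H"
proof -
  have "Frobenius H + h \<in> H" if "h \<in> H" "h \<noteq> 0" for h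
  proof (rule ccontr)
    assume "Frobenius H + h \<notin> H"
    then have "h \<le> 0" using Frobenius_greatest(2)[OF assms] by fastforce
    then show False using that assms by (auto simp: numerical_semigroup_def)
  qed
  then show ?thesis using Frobenius_greatest(1)[OF assms] by (simp add: pseudo_Frobenius_def)
qed

text \<open>The largest \<open>h \<in> H\<close> for which \<open>x + h\<close> is still a gap leads to a pseudo-Frobenius number; it
  exists because the gaps are bounded above.\<close>
lemma pseudo_Frobenius_above_gap:
  assumes H: "numerical_semigroup H" and x: "x \<notin> H"
  shows "\<exists>h\<in>H. x + h \<in> pseudo_Frobenius H"
proof -
  let ?P = "\<lambda>h. h \<in> H \<and> x + h \<notin> H"
  have P0: "?P 0" using H x by (simp add: numerical_semigroup_def)
  have bound: "h \<le> Frobenius H - x" if "?P h" for h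
    using that Frobenius_greatest(2)[OF H, of "x + h"] by simp
  define g where "g = Greatest ?P"
  have g: "g \<in> H" "x + g \<notin> H" and max: "\<And>h. ?P h \<Longrightarrow> h \<le> g"
    using Greatest_int[of ?P, OF P0 bound] by (auto simp: g_def)
  have "x + g + h \<in> H" if h: "h \<in> H" "h \<noteq> 0" for h
  proof (rule ccontr)
    assume "x + g + h \<notin> H"
    moreover have "g + h \<in> H" using H g h by (simp add: numerical_semigroup_def)
    ultimately have "g + h \<le> g" using max[of "g + h"] by (simp add: add.assoc)
    then show False using h H by (auto simp: numerical_semigroup_def)
  qed
  then show ?thesis using g by (auto simp: pseudo_Frobenius_def)
qed

text \<open>Nari's symmetry criterion. If \<open>x\<close> and \<open>Frobenius H - x\<close> are both gaps, then the
  pseudo-Frobenius number \<open>x + g\<close> above \<open>x\<close> cannot be \<open>Frobenius H\<close>, and its dual plus \<open>g\<close> is the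
  gap \<open>Frobenius H - x\<close>. This forces \<open>g = 0\<close>, so that \<open>x\<close> itself is pseudo-Frobenius.\<close>
lemma almost_symmetric_iff_pseudo_Frobenius_dual:
  assumes H: "numerical_semigroup H"
  shows "almost_symmetric H \<longleftrightarrow>
    (\<forall>f\<in>pseudo_Frobenius H. f \<noteq> Frobenius H \<longrightarrow> Frobenius H - f \<in> pseudo_Frobenius H)"
proof
  assume "almost_symmetric H"
  then have AS: "h + x \<in> H" if "h \<in> H" "h \<noteq> 0" "0 \<le> x" "Frobenius H - x \<notin> H" for h x
    using that by (auto simp: almost_symmetric_def maximal_ideal_def canonical_ideal_def)
  show "\<forall>f\<in>pseudo_Frobenius H. f \<noteq> Frobenius H \<longrightarrow> Frobenius H - f \<in> pseudo_Frobenius H"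
  proof (intro ballI impI)
    fix f assume f: "f \<in> pseudo_Frobenius H" "f \<noteq> Frobenius H"
    have fH: "f \<notin> H" using f by (simp add: pseudo_Frobenius_def)
    have "Frobenius H - f \<notin> H"
    proof
      assume "Frobenius H - f \<in> H"
      then have "f + (Frobenius H - f) \<in> H"
        using f unfolding pseudo_Frobenius_def by auto
      then show False using Frobenius_greatest(1)[OF H] by simp
    qed
    moreover have "Frobenius H - f + h \<in> H" if "h \<in> H" "h \<noteq> 0" for h
      using AS[OF that, of "Frobenius H - f"] Frobenius_greatest(2)[OF H fH] fH
      by (simp add: add.commute)
    ultimately show "Frobenius H - f \<in> pseudo_Frobenius H"
      by (simp add: pseudo_Frobenius_def)
  qed
next
  assume dual: "\<forall>f\<in>pseudo_Frobenius H. f \<noteq> Frobenius H \<longrightarrow> Frobenius H - f \<in> pseudo_Frobenius H"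
  have "h + x \<in> H - {0}" if h: "h \<in> H" "h \<noteq> 0" and x: "0 \<le> x" "Frobenius H - x \<notin> H" for h x
  proof -
    have "h > 0" using h H by (auto simp: numerical_semigroup_def)
    moreover have "h + x \<in> H"
    proof (cases "x \<in> H")
      case True
      then show ?thesis using h H by (simp add: numerical_semigroup_def)
    next
      case False
      then obtain g where g: "g \<in> H" "x + g \<in> pseudo_Frobenius H"
        using pseudo_Frobenius_above_gap[OF H] by blast
      have "x + g \<noteq> Frobenius H" using g x(2) by (metis add_diff_cancel_left')
      then have F: "Frobenius H - (x + g) \<in> pseudo_Frobenius H" using dual g by blast
      have "g = 0"
      proof (rule ccontr)
        assume "g \<noteq> 0"
        then have "Frobenius H - (x + g) + g \<in> H" using F g unfolding pseudo_Frobenius_def by blast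
        then show False using x(2) by simp
      qed
      then show ?thesis using g h by (simp add: pseudo_Frobenius_def add.commute)
    qed
    ultimately show ?thesis using x by simp
  qed
  then show "almost_symmetric H"
    using H by (auto simp: almost_symmetric_def maximal_ideal_def canonical_ideal_def)
qed

section \<open>Factorization lengths in the semigroup of differences\<close>

text \<open>Two of the prefix sums agree modulo \<open>m\<close>; the segment between these prefixes has a sum
  divisible by \<open>m\<close>.\<close>
lemma zero_sum_segment:
  fixes xs :: "int list"
  assumes "0 < m" and "m \<le> int (length xs)"
  obtains us vs ws where "xs = us @ vs @ ws" "vs \<noteq> []" "m dvd sum_list vs"
proof -
  define f where "f = (\<lambda>p. sum_list (take p xs) mod m)"
  have "f ` {..nat m} \<subseteq> {0..<m}" using assms(1) by (auto simp: f_def)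
  then have "card (f ` {..nat m}) \<le> nat m" using card_mono[of "{0..<m}"] by fastforce
  then have "\<not> inj_on f {..nat m}" by (intro pigeonhole) simp
  then obtain p q where pq: "p < q" "q \<le> nat m" "f p = f q"
    unfolding inj_on_def by (metis atMost_iff linorder_neqE_nat)
  define vs where "vs = take (q - p) (drop p xs)"
  have take_q: "take q xs = take p xs @ vs"
    using pq(1) take_add[of p "q - p" xs] by (simp add: vs_def)
  have "m dvd sum_list (take q xs) - sum_list (take p xs)"
    using pq(3) unfolding f_def by (metis mod_eq_dvd_iff)
  then have "m dvd sum_list vs" by (simp add: take_q)
  moreover have "vs \<noteq> []" using pq assms by (auto simp: vs_def)
  moreover have "xs = take p xs @ vs @ drop q xs"
    using append_take_drop_id[of q xs] by (simp add: take_q)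
  ultimately show ?thesis using that by blast
qed

lemma Gcd_bezout_int:
  fixes f :: "'a \<Rightarrow> int"
  assumes "finite A"
  shows "\<exists>z. Gcd (f ` A) = (\<Sum>j\<in>A. z j * f j)"
  using assms
proof (induction A rule: finite_induct)
  case (insert a A)
  then obtain z where z: "Gcd (f ` A) = (\<Sum>j\<in>A. z j * f j)" by blast
  obtain u v where uv: "u * f a + v * Gcd (f ` A) = gcd (f a) (Gcd (f ` A))"
    using bezout_int by blast
  have "(\<Sum>j\<in>A. (if j = a then u else v * z j) * f j) = (\<Sum>j\<in>A. v * (z j * f j))"
    using insert.hyps by (intro sum.cong) auto
  then show ?case using insert.hyps uv z
    by (intro exI[of _ "\<lambda>j. if j = a then u else v * z j"]) (simp add: sum_distrib_left)
qed simp

locale shift_sequence =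
  fixes r :: "nat \<Rightarrow> int" and k :: nat
  assumes k_ge_2: "2 \<le> k" and r_0: "r 0 = 0" and r_Suc: "\<And>i. i < k \<Longrightarrow> r i < r (Suc i)"
begin

abbreviation "R \<equiv> r k"
abbreviation "S \<equiv> S_of r k"
abbreviation "d \<equiv> d_of r k"
abbreviation "F \<equiv> F_S r k"
abbreviation "len \<equiv> min_length r k"
abbreviation "M \<equiv> shifted_semigroup r k"

lemma r_mono: "i < j \<Longrightarrow> j \<le> k \<Longrightarrow> r i < r j"
proof (induction j)
  case (Suc j)
  then show ?case using r_Suc[of j] by (cases "i = j") auto
qed simp

lemma r_bounds: "j \<in> {1..k} \<Longrightarrow> 0 < r j \<and> r j \<le> R"
  using r_mono[of 0 j] r_mono[of j k] r_0 by (cases "j = k") auto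

lemma R_ge_2: "2 \<le> R"
  using r_mono[of 0 1] r_mono[of 1 k] r_0 k_ge_2 by simp

lemma d_pos: "0 < d"
proof -
  have "R \<in> r ` {1..k}" using k_ge_2 by simp
  then have "d \<noteq> 0" using R_ge_2 by (auto simp: d_of_def)
  moreover have "0 \<le> d" by (simp add: d_of_def)
  ultimately show ?thesis by simp
qed

lemma d_dvd_r: "j \<in> {1..k} \<Longrightarrow> d dvd r j"
  by (auto simp: d_of_def)

lemma d_dvd_R: "d dvd R" using d_dvd_r k_ge_2 by simp

lemma d_le_R: "d \<le> R" using d_dvd_R R_ge_2 by (intro zdvd_imp_le) auto

text \<open>Lists of generators, rather than coefficient vectors, make the pigeonhole argument on
  segments available.\<close>
definition factors :: "int \<Rightarrow> nat \<Rightarrow> bool" where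
  "factors x l \<longleftrightarrow> (\<exists>xs. set xs \<subseteq> r ` {1..k} \<and> sum_list xs = x \<and> length xs = l)"

lemma factors_iff_coefficients:
  "factors x l \<longleftrightarrow>
    (\<exists>c :: nat \<Rightarrow> nat. x = (\<Sum>j\<in>{1..k}. int (c j) * r j) \<and> l = (\<Sum>j\<in>{1..k}. c j))"
proof
  assume "factors x l"
  then obtain xs where "set xs \<subseteq> r ` {1..k}" "sum_list xs = x" "length xs = l"
    by (auto simp: factors_def)
  then show "\<exists>c :: nat \<Rightarrow> nat. x = (\<Sum>j\<in>{1..k}. int (c j) * r j) \<and> l = (\<Sum>j\<in>{1..k}. c j)"
  proof (induction xs arbitrary: x l)
    case Nil
    then show ?case by (intro exI[of _ "\<lambda>_. 0"]) auto
  next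
    case (Cons y ys)
    have "set ys \<subseteq> r ` {1..k}" using Cons.prems by simp
    from Cons.IH[OF this refl refl] obtain c :: "nat \<Rightarrow> nat"
      where c: "sum_list ys = (\<Sum>j\<in>{1..k}. int (c j) * r j)" "length ys = (\<Sum>j\<in>{1..k}. c j)"
      by blast
    from Cons.prems obtain i where i: "i \<in> {1..k}" "y = r i" by auto
    have "(\<Sum>j\<in>{1..k}. int (c j + (if j = i then 1 else 0)) * r j)
        = (\<Sum>j\<in>{1..k}. int (c j) * r j) + (\<Sum>j\<in>{1..k}. if j = i then r j else 0)"
      by (subst sum.distrib[symmetric], rule sum.cong) (auto simp: algebra_simps)
    moreover have "(\<Sum>j\<in>{1..k}. c j + (if j = i then 1 else 0)) = (\<Sum>j\<in>{1..k}. c j) + 1"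
      using i by (simp add: sum.distrib)
    ultimately show ?case using Cons.prems c i
      by (intro exI[of _ "\<lambda>j. c j + (if j = i then 1 else 0)"]) auto
  qed
next
  assume "\<exists>c :: nat \<Rightarrow> nat. x = (\<Sum>j\<in>{1..k}. int (c j) * r j) \<and> l = (\<Sum>j\<in>{1..k}. c j)"
  then obtain c :: "nat \<Rightarrow> nat" where c: "x = (\<Sum>j\<in>{1..k}. int (c j) * r j)"
    "l = (\<Sum>j\<in>{1..k}. c j)" by auto
  define xs where "xs = concat (map (\<lambda>j. replicate (c j) (r j)) [1..<Suc k])"
  have set: "{1..<Suc k} = {1..k}" by auto
  have "set xs \<subseteq> r ` {1..k}" by (auto simp: xs_def)
  moreover have "sum_list (concat yss) = sum_list (map sum_list yss)" for yss :: "int list list"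
    by (induction yss) auto
  then have "sum_list xs = x"
    by (simp add: xs_def c(1) o_def sum_list_replicate interv_sum_list_conv_sum_set_nat
        atLeastLessThanSuc_atLeastAtMost del: upt_Suc sum.op_ivl_Suc)
  moreover have "length xs = l"
    unfolding xs_def c(2) length_concat map_map o_def length_replicate
      interv_sum_list_conv_sum_set_nat set_upt set by simp
  ultimately show "factors x l" by (auto simp: factors_def)
qed

lemma S_iff_factors: "x \<in> S \<longleftrightarrow> (\<exists>l. factors x l)"
  unfolding factors_iff_coefficients S_of_def semigroup_gen_def by auto

lemma len_eq_Least: "len x = int (LEAST l. factors x l)"
  unfolding min_length_def factors_iff_coefficients ..

lemma factors_len: "x \<in> S \<Longrightarrow> factors x (nat (len x))"
  using LeastI_ex[of "factors x"] by (simp add: S_iff_factors len_eq_Least)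

lemma len_le: "factors x l \<Longrightarrow> len x \<le> int l"
  by (simp add: len_eq_Least Least_le)

lemma len_nonneg: "0 \<le> len x" by (simp add: len_eq_Least)

lemma factors_0: "factors 0 0" by (simp add: factors_def)

lemma factors_add: "factors x a \<Longrightarrow> factors y b \<Longrightarrow> factors (x + y) (a + b)"
  unfolding factors_def by (metis length_append set_append sum_list_append Un_least)

lemma factors_generator: "j \<in> {1..k} \<Longrightarrow> factors (r j) 1"
  unfolding factors_def by (intro exI[of _ "[r j]"]) auto

lemma factors_SucE:
  assumes "factors x (Suc l)"
  obtains j where "j \<in> {1..k}" "factors (x - r j) l"
proof -
  from assms obtain y ys where "set (y # ys) \<subseteq> r ` {1..k}" "sum_list (y # ys) = x" "length ys = l"
    unfolding factors_def by (metis length_Suc_conv)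
  then show ?thesis using that by (force simp: factors_def)
qed

lemma zero_in_S: "0 \<in> S" using factors_0 S_iff_factors by blast

lemma S_add: "x \<in> S \<Longrightarrow> y \<in> S \<Longrightarrow> x + y \<in> S"
  unfolding S_iff_factors using factors_add by blast

lemma generator_in_S: "j \<in> {1..k} \<Longrightarrow> r j \<in> S"
  using factors_generator S_iff_factors by blast

lemma len_add: "x \<in> S \<Longrightarrow> y \<in> S \<Longrightarrow> len (x + y) \<le> len x + len y"
  using len_le[OF factors_add[OF factors_len factors_len], of x y] len_nonneg[of x] len_nonneg[of y]
  by simp

lemma len_add_generator: "x \<in> S \<Longrightarrow> j \<in> {1..k} \<Longrightarrow> len (x + r j) \<le> len x + 1"
  using len_add[of x "r j"] generator_in_S len_le[OF factors_generator, of j] by fastforce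

lemma factors_bounds:
  assumes "factors x l"
  shows "0 \<le> x \<and> x \<le> int l * R \<and> d dvd x"
  using assms
proof (induction l arbitrary: x)
  case 0
  then show ?case by (simp add: factors_def)
next
  case (Suc l)
  from Suc.prems obtain j where j: "j \<in> {1..k}" "factors (x - r j) l" by (rule factors_SucE)
  then have "d dvd (x - r j) + r j" using Suc.IH d_dvd_r by (metis dvd_add)
  then show ?case using Suc.IH[OF j(2)] r_bounds[OF j(1)] by (auto simp: algebra_simps)
qed

lemma S_nonneg: "x \<in> S \<Longrightarrow> 0 \<le> x"
  and d_dvd_S: "x \<in> S \<Longrightarrow> d dvd x"
  using factors_bounds by (auto simp: S_iff_factors)

lemma le_len_mult_R: "x \<in> S \<Longrightarrow> x \<le> len x * R"
  using factors_bounds[OF factors_len, of x] len_nonneg[of x] by simp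

text \<open>In a shortest factorization, \<open>a\<close> counts the generators other than \<open>R\<close>, \<open>y\<close> is their sum and
  \<open>b\<close> counts the copies of \<open>R\<close>. The point is \<open>a < R\<close>: otherwise some of the \<open>a\<close> generators, say
  \<open>p\<close> of them, have a sum \<open>q * R\<close>, and \<open>q < p\<close> since each is below \<open>R\<close>; \<open>q\<close> copies of \<open>R\<close> would
  give a shorter factorization.\<close>
lemma minimal_factorization:
  assumes "x \<in> S"
  obtains a b :: nat and y where "len x = int (a + b)" "x = y + int b * R" "int a < R"
    "0 \<le> y" "y \<le> int a * (R - 1)" "0 < b \<Longrightarrow> factors (x - R) (a + (b - 1))"
proof -
  have G: "g \<in> r ` {1..k} \<Longrightarrow> 0 < g \<and> g \<le> R" for g using r_bounds by blast
  have RG: "R \<in> r ` {1..k}" using k_ge_2 by simp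
  obtain xs where xs: "set xs \<subseteq> r ` {1..k}" "sum_list xs = x" "length xs = nat (len x)"
    using factors_len[OF assms] by (auto simp: factors_def)
  define ys where "ys = filter (\<lambda>g. g \<noteq> R) xs"
  define b where "b = length (filter (\<lambda>g. g = R) xs)"
  have "sum_list xs = sum_list ys + int b * R" unfolding ys_def b_def
    by (induction xs) (auto simp: algebra_simps)
  then have x: "x = sum_list ys + int b * R" using xs by simp
  have "length xs = length ys + b" unfolding ys_def b_def
    by (induction xs) auto
  then have len: "len x = int (length ys + b)" using xs len_nonneg[of x] by simp
  have ysG: "set ys \<subseteq> r ` {1..k}" using xs by (auto simp: ys_def)
  have small: "0 \<le> sum_list zs \<and> sum_list zs \<le> int (length zs) * (R - 1)"
    if "set zs \<subseteq> set ys" for zs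
    using that
  proof (induction zs)
    case (Cons g zs)
    then have "0 < g" "g \<le> R" "g \<noteq> R" using G ysG by (auto simp: ys_def)
    then show ?case using Cons by (auto simp: algebra_simps)
  qed simp
  have "int (length ys) < R"
  proof (rule ccontr)
    assume "\<not> int (length ys) < R"
    then obtain us vs ws where split: "ys = us @ vs @ ws" "vs \<noteq> []" "R dvd sum_list vs"
      using zero_sum_segment[of R ys] R_ge_2 by auto
    then obtain q where q: "sum_list vs = R * q" by (auto elim: dvdE)
    have "0 \<le> R * q" using small[of vs] split q by auto
    then have q0: "0 \<le> q" using R_ge_2 by (simp add: zero_le_mult_iff)
    have "R * q \<le> int (length vs) * (R - 1)" using small[of vs] split q by auto
    also have "\<dots> < R * int (length vs)" using split by (simp add: algebra_simps)
    finally have "q < int (length vs)" using R_ge_2 by simp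
    moreover have "factors x (length (us @ ws @ replicate (nat q + b) R))"
      unfolding factors_def
    proof (intro exI[of _ "us @ ws @ replicate (nat q + b) R"] conjI)
      show "set (us @ ws @ replicate (nat q + b) R) \<subseteq> r ` {1..k}"
        using ysG RG split by auto
      show "sum_list (us @ ws @ replicate (nat q + b) R) = x"
        using x split(1) q q0 by (simp add: sum_list_replicate algebra_simps)
    qed simp
    ultimately show False using len_le[of x] len q0 split(1) by fastforce
  qed
  moreover have "factors (x - R) (length ys + (b - 1))" if "0 < b"
    unfolding factors_def
  proof (intro exI[of _ "ys @ replicate (b - 1) R"] conjI)
    show "set (ys @ replicate (b - 1) R) \<subseteq> r ` {1..k}" using ysG RG by auto
    show "sum_list (ys @ replicate (b - 1) R) = x - R"
      using that x by (simp add: sum_list_replicate of_nat_diff algebra_simps)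
  qed simp
  ultimately show ?thesis using that[of "length ys" b "sum_list ys"] len x small[of ys] by blast
qed

text \<open>Together with \<open>le_len_mult_R\<close>, this determines \<open>len x\<close> up to an error less than \<open>R\<close>. For
  \<open>n > R * R\<close> that error is too small to reverse a difference of \<open>d * n\<close> between elements.\<close>
lemma len_mult_R_le:
  assumes "x \<in> S"
  shows "len x * R \<le> R * R - R + x"
proof -
  obtain a b :: nat and y where *: "len x = int (a + b)" "x = y + int b * R" "int a < R" "0 \<le> y"
    using minimal_factorization[OF assms] by metis
  have "int a * R \<le> (R - 1) * R" using * R_ge_2 by (intro mult_right_mono) auto
  then show ?thesis using * by (simp add: algebra_simps)
qed

text \<open>If a shortest factorization of \<open>x + R\<close> used \<open>R\<close>, dropping it would give
  \<open>len x < len (x + R)\<close>. So it consists of fewer than \<open>R\<close> generators, each at most \<open>R - 1\<close>.\<close>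
lemma len_add_R_le_imp:
  assumes x: "x \<in> S" and le: "len (x + R) \<le> len x"
  shows "x + R \<le> (R - 1) * (R - 1)"
proof -
  have "x + R \<in> S" using S_add[OF x generator_in_S[of k]] k_ge_2 by simp
  then obtain a b :: nat and y where *: "len (x + R) = int (a + b)" "x + R = y + int b * R"
    "int a < R" "y \<le> int a * (R - 1)" "0 < b \<Longrightarrow> factors (x + R - R) (a + (b - 1))"
    using minimal_factorization by metis
  have "b = 0"
  proof (rule ccontr)
    assume "b \<noteq> 0"
    then have "factors x (a + (b - 1))" using *(5) by simp
    then have "len x \<le> int (a + (b - 1))" by (rule len_le)
    moreover have "int (a + (b - 1)) < int (a + b)" using \<open>b \<noteq> 0\<close> by simp
    ultimately show False using *(1) le by linarith
  qed
  moreover have "int a * (R - 1) \<le> (R - 1) * (R - 1)"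
    using * R_ge_2 by (intro mult_right_mono) auto
  ultimately show ?thesis using * by simp
qed

lemma R_square: "(R - 1) * (R - 1) = R * R - 2 * R + 1" "2 * R \<le> R * R"
  using R_ge_2 by (auto simp: algebra_simps)

lemma len_add_R:
  assumes "x \<in> S" "R * R - R \<le> x"
  shows "len (x + R) = len x + 1"
  using len_add_R_le_imp[OF assms(1)] len_add_generator[OF assms(1), of k] assms(2) k_ge_2
    R_square R_ge_2 by force

lemma len_add_mult_R:
  assumes "x \<in> S" "R * R - R \<le> x"
  shows "x + int t * R \<in> S \<and> len (x + int t * R) = len x + int t"
proof (induction t)
  case (Suc t)
  have "R * R - R \<le> x + int t * R" using assms R_ge_2 by (simp add: add_increasing2)
  then have "len (x + int t * R + R) = len x + int t + 1" using Suc len_add_R by simp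
  moreover have "x + int t * R + R \<in> S" using Suc S_add generator_in_S[of k] k_ge_2 by simp
  ultimately show ?case by (simp add: algebra_simps)
qed (use assms in simp)

text \<open>By Bezout, a multiple of \<open>d\<close> is an integer combination of the generators. The coefficients of
  the generators other than \<open>R\<close> can be reduced modulo \<open>R\<close>, at the expense of the coefficient of
  \<open>R\<close>, which stays nonnegative if the multiple is large.\<close>
lemma S_contains_large_multiples: "\<exists>B. \<forall>x\<ge>B. d dvd x \<longrightarrow> x \<in> S"
proof -
  obtain z where z: "d = (\<Sum>j\<in>{1..k}. z j * r j)"
    using Gcd_bezout_int[of "{1..k}" r] by (auto simp: d_of_def)
  have split: "{1..k} = insert k {1..<k}" using k_ge_2 by auto
  have "x \<in> S" if x: "(\<Sum>j\<in>{1..<k}. R * r j) \<le> x" and "d dvd x" for x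
  proof -
    obtain t where "x = d * t" using \<open>d dvd x\<close> by (auto elim: dvdE)
    then have xt: "x = (\<Sum>j\<in>{1..k}. t * z j * r j)"
      by (simp add: z sum_distrib_left sum_distrib_right mult_ac)
    define C where "C = t * z k + (\<Sum>j\<in>{1..<k}. (t * z j) div R * r j)"
    have "(\<Sum>j\<in>{1..<k}. t * z j * r j)
        = (\<Sum>j\<in>{1..<k}. (t * z j) mod R * r j + R * ((t * z j) div R * r j))"
      by (intro sum.cong refl)
        (metis (no_types, opaque_lifting) distrib_right mod_mult_div_eq mult.assoc)
    then have xC: "x = (\<Sum>j\<in>{1..<k}. (t * z j) mod R * r j) + R * C"
      unfolding xt C_def split by (simp add: sum.distrib sum_distrib_left algebra_simps)
    have "(\<Sum>j\<in>{1..<k}. (t * z j) mod R * r j) \<le> (\<Sum>j\<in>{1..<k}. R * r j)"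
      using R_ge_2 r_bounds by (intro sum_mono mult_right_mono) (auto simp: less_imp_le)
    then have "0 \<le> R * C" using x xC by linarith
    then have "0 \<le> C" using R_ge_2 by (simp add: zero_le_mult_iff)
    define c where "c = (\<lambda>j. if j = k then nat C else nat ((t * z j) mod R))"
    have "(\<Sum>j\<in>{1..<k}. int (c j) * r j) = (\<Sum>j\<in>{1..<k}. (t * z j) mod R * r j)"
      using R_ge_2 by (intro sum.cong) (auto simp: c_def)
    then have "x = (\<Sum>j\<in>{1..k}. int (c j) * r j)"
      unfolding split using xC \<open>0 \<le> C\<close> by (simp add: c_def)
    then show "x \<in> S" unfolding S_iff_factors factors_iff_coefficients by blast
  qed
  then show ?thesis by blast
qed

lemma F_notin_S: "F \<notin> S"
  and d_dvd_F: "d dvd F"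
  and notin_S_le_F: "\<And>x. d dvd x \<Longrightarrow> x \<notin> S \<Longrightarrow> x \<le> F"
proof -
  let ?P = "\<lambda>s. s \<notin> S \<and> [s = 0] (mod d)"
  obtain B where B: "\<And>x. B \<le> x \<Longrightarrow> d dvd x \<Longrightarrow> x \<in> S"
    using S_contains_large_multiples by blast
  have "?P (- d)" using S_nonneg[of "- d"] d_pos by (auto simp: cong_0_iff)
  moreover have "x \<le> B" if "?P x" for x using that B[of x] by (force simp: cong_0_iff)
  ultimately have "?P F" "\<And>x. ?P x \<Longrightarrow> x \<le> F"
    unfolding F_S_def using Greatest_int[of ?P "- d" B] by blast+
  then show "F \<notin> S" "d dvd F" "\<And>x. d dvd x \<Longrightarrow> x \<notin> S \<Longrightarrow> x \<le> F"
    by (auto simp: cong_0_iff)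
qed

lemma F_ge: "- d \<le> F"
  using notin_S_le_F[of "- d"] S_nonneg[of "- d"] d_pos by auto

section \<open>Pseudo-Frobenius numbers of a shifted semigroup\<close>

text \<open>The inequality \<open>len i \<le> t\<close> is enough on the right, since copies of the generator \<open>n + r 0 = n\<close>
  fill up a factorization of \<open>i\<close> to length \<open>t\<close>.\<close>
lemma shifted_semigroup_iff: "x \<in> M n \<longleftrightarrow> (\<exists>i t. i \<in> S \<and> len i \<le> t \<and> x = i + t * n)"
proof -
  have set: "{0..k} = insert 0 {1..k}" by auto
  have expand: "(\<Sum>j\<in>{0..k}. int (c j) * (n + r j))
      = (\<Sum>j\<in>{1..k}. int (c j) * r j) + int (c 0 + (\<Sum>j\<in>{1..k}. c j)) * n" for c :: "nat \<Rightarrow> nat"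
    unfolding set by (simp add: r_0 sum.distrib sum_distrib_left sum_distrib_right algebra_simps)
  show ?thesis
  proof
    assume "x \<in> M n"
    then obtain c :: "nat \<Rightarrow> nat" where c: "x = (\<Sum>j\<in>{0..k}. int (c j) * (n + r j))"
      by (auto simp: shifted_semigroup_def semigroup_gen_def)
    have fac: "factors (\<Sum>j\<in>{1..k}. int (c j) * r j) (\<Sum>j\<in>{1..k}. c j)"
      unfolding factors_iff_coefficients by blast
    then have "len (\<Sum>j\<in>{1..k}. int (c j) * r j) \<le> int (c 0 + (\<Sum>j\<in>{1..k}. c j))"
      using len_le[OF fac] by simp
    then show "\<exists>i t. i \<in> S \<and> len i \<le> t \<and> x = i + t * n"
      using fac c expand S_iff_factors by blast
  next
    assume "\<exists>i t. i \<in> S \<and> len i \<le> t \<and> x = i + t * n"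
    then obtain i t where it: "i \<in> S" "len i \<le> t" "x = i + t * n" by blast
    then obtain c :: "nat \<Rightarrow> nat" where c: "i = (\<Sum>j\<in>{1..k}. int (c j) * r j)"
      "nat (len i) = (\<Sum>j\<in>{1..k}. c j)"
      using factors_len factors_iff_coefficients by metis
    define c' where "c' = c(0 := nat (t - len i))"
    have "(\<Sum>j\<in>{1..k}. int (c' j) * r j) = (\<Sum>j\<in>{1..k}. int (c j) * r j)"
      "(\<Sum>j\<in>{1..k}. c' j) = (\<Sum>j\<in>{1..k}. c j)"
      by (auto simp: c'_def intro!: sum.cong)
    then have "(\<Sum>j\<in>{1..k}. int (c' j) * r j) = i" "(\<Sum>j\<in>{1..k}. c' j) = nat (len i)"
      using c by simp_all
    then have "x = (\<Sum>j\<in>{0..k}. int (c' j) * (n + r j))"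
      unfolding expand using it len_nonneg[of i] by (simp add: c'_def)
    then show "x \<in> M n"
      unfolding shifted_semigroup_def semigroup_gen_def by blast
  qed
qed

text \<open>These index the pseudo-Frobenius numbers of \<open>M n\<close> that come from small elements of \<open>S\<close>, for
  every sufficiently large \<open>n\<close> at once.\<close>
definition low_indices :: "int set" where
  "low_indices = {i \<in> S. \<forall>j\<in>{1..k}. len (i + r j) \<le> len i}"

lemma low_indices_bound: "i \<in> low_indices \<Longrightarrow> 0 \<le> i \<and> i + R \<le> R * R - 2 * R + 1"
  using len_add_R_le_imp[of i] k_ge_2 R_square S_nonneg[of i] by (simp add: low_indices_def)

text \<open>For large \<open>n\<close>, the numbers \<open>i + len i * n\<close> with \<open>i\<close> in the Apery set of \<open>S\<close> form the Apery
  set of \<open>M n\<close> with respect to \<open>n\<close>. The indices singled out here are those of its maximal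
  elements for divisibility in \<open>M n\<close>, and \<open>pf_value\<close> is the corresponding pseudo-Frobenius
  number.\<close>
definition pf_indices :: "int \<Rightarrow> int set" where
  "pf_indices n = {i \<in> Apery S (d * n).
     \<forall>j\<in>{1..k}. i + r j - d * n \<notin> S \<longrightarrow> len (i + r j) \<le> len i}"

definition pf_value :: "int \<Rightarrow> int \<Rightarrow> int" where
  "pf_value n i = i + (len i - 1) * n"

lemma pf_value_add:
  assumes "i + j = e" "len i + len j = len e + 1"
  shows "pf_value n i + pf_value n j = pf_value n e"
proof -
  have "(len i - 1) * n + (len j - 1) * n = (len e - 1) * n"
    unfolding distrib_right[symmetric] using assms(2) by simp
  then show ?thesis using assms(1) by (simp add: pf_value_def)
qed

end

locale large_shift = shift_sequence +
  fixes n :: int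
  assumes n_gt_N0: "N0 r k < n" and coprime_n_d: "coprime n d"
begin

abbreviation "D \<equiv> d * n"

lemma n_bounds: "R * R < n" "R * R + 2 * F < n"
proof -
  have *: "R * R < n" "R * R + F * R < n"
    using n_gt_N0 by (auto simp: N0_def power2_eq_square)
  show "R * R < n" by (fact *)
  \<comment> \<open>The factor 2 is available because \<open>R \<ge> 2\<close>; it turns the later size estimates into linear
    arithmetic in \<open>R * R\<close>, \<open>R\<close>, \<open>F\<close> and \<open>d * n\<close>.\<close>
  show "R * R + 2 * F < n"
  proof (cases "0 \<le> F")
    case True
    then have "F * 2 \<le> F * R" using R_ge_2 by (intro mult_left_mono) auto
    then show ?thesis using * by simp
  qed (use * in simp)
qed

lemma n_pos: "0 < n" using n_bounds R_square R_ge_2 by linarith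

lemma D_ge_n: "n \<le> D" using n_pos d_pos by (simp add: mult_le_cancel_right1)

lemma D_bounds: "R * R < D" "R * R + 2 * F < D" "0 < D"
  using n_bounds D_ge_n n_pos by linarith+

lemma apery_bounds:
  assumes "i \<in> Apery S D"
  shows "0 \<le> i" "i \<le> D + F" "d dvd i"
proof -
  have i: "i \<in> S" "i - D \<notin> S" using assms by (auto simp: Apery_def)
  show "0 \<le> i" "d dvd i" using i S_nonneg d_dvd_S by auto
  then show "i \<le> D + F" using notin_S_le_F[of "i - D"] i by simp
qed

lemma multiple_D_in_S: "0 \<le> q \<Longrightarrow> q * D \<in> S"
proof (cases "q = 0")
  case False
  assume "0 \<le> q"
  then have "1 * D \<le> q * D" using False D_bounds by (intro mult_right_mono) auto
  moreover have "F < D" using D_bounds R_square R_ge_2 by linarith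
  ultimately show ?thesis using notin_S_le_F[of "q * D"] by fastforce
qed (use zero_in_S in simp)

lemma len_less:
  assumes "i \<in> S" "i' \<in> S" "i + D \<le> i'"
  shows "len i < len i'"
proof -
  have "len i * R < len i' * R"
    using len_mult_R_le[OF assms(1)] le_len_mult_R[OF assms(2)] assms(3) D_bounds R_ge_2 by linarith
  then show ?thesis using R_ge_2 by simp
qed

text \<open>Elements of \<open>S\<close> are multiples of \<open>d\<close>, so congruence modulo \<open>n\<close> is congruence modulo \<open>d * n\<close>.
  An Apery element is the least element of \<open>S\<close> in its class, because \<open>S\<close> contains all nonnegative
  multiples of \<open>d * n\<close>.\<close>
lemma apery_least:
  assumes i: "i \<in> Apery S D" and i': "i' \<in> S" and cong: "n dvd i' - i"
  obtains q where "0 \<le> q" "i' = i + q * D"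
proof -
  have "d dvd i' - i" using apery_bounds[OF i] d_dvd_S[OF i'] by simp
  then have "d * n dvd i' - i" using cong coprime_n_d
    by (simp add: divides_mult coprime_commute)
  then obtain q where "i' - i = D * q" by (auto elim: dvdE)
  then have q: "i' = i + q * D" by (simp add: algebra_simps)
  have "0 \<le> q"
  proof (rule ccontr)
    assume "\<not> 0 \<le> q"
    then have "i' + (- q - 1) * D \<in> S" by (intro S_add i' multiple_D_in_S) simp
    moreover have "i' + (- q - 1) * D = i - D" using q by (simp add: algebra_simps)
    ultimately show False using i by (simp add: Apery_def)
  qed
  then show ?thesis using that q by blast
qed

lemma apery_unique:
  assumes "i \<in> Apery S D" "i' \<in> Apery S D" "n dvd i' - i"
  shows "i = i'"
proof -
  have "i \<in> S" "i' \<in> S" using assms by (auto simp: Apery_def)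
  moreover have "n dvd i - i'" using assms(3) by (simp add: dvd_diff_commute)
  ultimately obtain p q where "0 \<le> p" "i' = i + p * D" "0 \<le> q" "i = i' + q * D"
    using apery_least assms by metis
  moreover have "0 \<le> p * D" "0 \<le> q * D" using \<open>0 \<le> p\<close> \<open>0 \<le> q\<close> D_bounds by simp_all
  ultimately show ?thesis by linarith
qed

text \<open>The Chinese remainder theorem provides a multiple \<open>u\<close> of \<open>d\<close> with \<open>0 \<le> u < d * n\<close> in the
  class of \<open>x\<close> modulo \<open>n\<close>; either \<open>u\<close> or, if \<open>u\<close> is a gap of \<open>S\<close>, \<open>u + d * n\<close> is an Apery
  element.\<close>
lemma apery_representative: "\<exists>i\<in>Apery S D. \<exists>t. x = i + t * n"
proof -
  obtain y where y: "[y = x] (mod n)" "[y = 0] (mod d)"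
    using binary_chinese_remainder_int[OF coprime_n_d] by blast
  define u where "u = y mod D"
  have u: "0 \<le> u" "u < D" using D_bounds by (auto simp: u_def)
  have "n dvd u - y" "d dvd u - y"
    using mod_eq_dvd_iff[of u D y] by (auto simp: u_def intro: dvd_mult_left dvd_mult_right)
  moreover have "n dvd y - x" "d dvd y" using y by (auto simp: cong_iff_dvd_diff)
  ultimately have "n dvd (u - y) + (y - x)" "d dvd (u - y) + y" by (blast intro: dvd_add)+
  then have dvd: "n dvd u - x" "d dvd u" by simp_all
  have "\<exists>i\<in>Apery S D. n dvd i - x"
  proof (cases "u \<in> S")
    case True
    then have "u \<in> Apery S D" using u S_nonneg[of "u - D"] by (auto simp: Apery_def)
    then show ?thesis using dvd by blast
  next
    case False
    have "F < D" using D_bounds R_square R_ge_2 by linarith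
    then have "u + D \<in> S" using notin_S_le_F[of "u + D"] u dvd by force
    then have "u + D \<in> Apery S D" using False by (simp add: Apery_def)
    moreover have "n dvd (u - x) + D" using dvd(1) by (intro dvd_add) simp_all
    then have "n dvd u + D - x" by (simp add: algebra_simps)
    ultimately show ?thesis by blast
  qed
  then obtain i t where "i \<in> Apery S D" "i - x = n * t" unfolding dvd_def by blast
  moreover from this have "x = i + (- t) * n" by (simp add: mult.commute)
  ultimately show ?thesis by blast
qed

text \<open>Any other element of \<open>S\<close> in the class of \<open>i\<close> is larger than \<open>i\<close> by at least \<open>d * n\<close>. By
  \<open>len_less\<close> it has a greater length, so it does not help to reach \<open>i + t * n\<close>.\<close>
lemma apery_in_M_iff:
  assumes i: "i \<in> Apery S D"
  shows "i + t * n \<in> M n \<longleftrightarrow> len i \<le> t"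
proof
  assume "len i \<le> t"
  then show "i + t * n \<in> M n" using i by (auto simp: shifted_semigroup_iff Apery_def)
next
  assume "i + t * n \<in> M n"
  then obtain i' t' where *: "i' \<in> S" "len i' \<le> t'" "i + t * n = i' + t' * n"
    by (auto simp: shifted_semigroup_iff)
  then have "i' - i = n * (t - t')" by (simp add: algebra_simps)
  then obtain q where q: "0 \<le> q" "i' = i + q * D" using apery_least[OF i *(1)] by auto
  then have "t * n = (t' + q * d) * n" using * by (simp add: algebra_simps)
  then have t: "t = t' + q * d" using n_pos by simp
  show "len i \<le> t"
  proof (cases "q = 0")
    case True
    then show ?thesis using * q t by simp
  next
    case False
    then have "1 * D \<le> q * D" using q D_bounds by (intro mult_right_mono) auto
    then have "len i < len i'" using len_less[of i i'] i * q by (simp add: Apery_def)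
    moreover have "0 \<le> q * d" using q d_pos by simp
    ultimately show ?thesis using * t by linarith
  qed
qed

lemma numerical_semigroup_M: "numerical_semigroup (M n)"
  unfolding numerical_semigroup_def
proof (intro conjI ballI)
  show "M n \<subseteq> {0..}"
  proof
    fix x assume "x \<in> M n"
    then obtain i t where "i \<in> S" "len i \<le> t" "x = i + t * n" by (auto simp: shifted_semigroup_iff)
    then show "x \<in> {0..}" using S_nonneg[of i] len_nonneg[of i] n_pos by simp
  qed
  show "0 \<in> M n"
    using zero_in_S len_le[OF factors_0] shifted_semigroup_iff[of 0 n]
    by (metis add.right_neutral mult_zero_left of_nat_0)
  show "x + y \<in> M n" if xy: "x \<in> M n" "y \<in> M n" for x y
  proof -
    obtain i t where "i \<in> S" "len i \<le> t" "x = i + t * n"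
      using xy(1) by (auto simp: shifted_semigroup_iff)
    moreover obtain i' t' where "i' \<in> S" "len i' \<le> t'" "y = i' + t' * n"
      using xy(2) by (auto simp: shifted_semigroup_iff)
    ultimately have "i + i' \<in> S" "len (i + i') \<le> t + t'" "x + y = (i + i') + (t + t') * n"
      using S_add len_add[of i i'] by (auto simp: algebra_simps)
    then show ?thesis unfolding shifted_semigroup_iff by blast
  qed
  have "x \<le> (D + F) + (R * R + D + F) * n" if x: "x \<notin> M n" for x
  proof -
    obtain i t where it: "i \<in> Apery S D" "x = i + t * n" using apery_representative by blast
    then have "t < len i" using apery_in_M_iff x by auto
    moreover have "i \<in> S" using it by (simp add: Apery_def)
    then have "len i * R \<le> R * R - R + i" by (rule len_mult_R_le)
    moreover have "len i * 1 \<le> len i * R" using R_ge_2 len_nonneg by (intro mult_left_mono) auto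
    ultimately have "t \<le> R * R + D + F" using apery_bounds[OF it(1)] R_ge_2 by linarith
    then have "t * n \<le> (R * R + D + F) * n" using n_pos by simp
    then show ?thesis using it apery_bounds[OF it(1)] by linarith
  qed
  then have "{0..} - M n \<subseteq> {0..(D + F) + (R * R + D + F) * n}" by auto
  then show "finite ({0..} - M n)" by (rule finite_subset) simp
qed

lemma peel_generator:
  assumes "h \<in> M n" "h \<noteq> 0"
  obtains j where "j \<in> {0..k}" "h - (n + r j) \<in> M n"
proof -
  obtain i t where it: "i \<in> S" "len i \<le> t" "h = i + t * n"
    using assms by (auto simp: shifted_semigroup_iff)
  show ?thesis
  proof (cases "len i = t")
    case False
    then have "len i \<le> t - 1" "h - (n + r 0) = i + (t - 1) * n"
      using it r_0 by (auto simp: algebra_simps)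
    then have "h - (n + r 0) \<in> M n" unfolding shifted_semigroup_iff using it by blast
    then show ?thesis using that[of 0] by simp
  next
    case True
    have "t \<noteq> 0"
    proof
      assume "t = 0"
      then have "i = 0" using le_len_mult_R[OF it(1)] S_nonneg[OF it(1)] True by simp
      then show False using assms it \<open>t = 0\<close> by simp
    qed
    then obtain l where l: "nat (len i) = Suc l"
      using True len_nonneg[of i] by (metis int_nat_eq not0_implies_Suc of_nat_0)
    then obtain j where j: "j \<in> {1..k}" "factors (i - r j) l"
      using factors_len[OF it(1)] factors_SucE by metis
    have "len (i - r j) \<le> t - 1" using len_le[OF j(2)] l True by simp
    moreover have "h - (n + r j) = (i - r j) + (t - 1) * n" using it by (simp add: algebra_simps)
    moreover have "i - r j \<in> S" using j S_iff_factors by blast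
    ultimately have "h - (n + r j) \<in> M n" unfolding shifted_semigroup_iff by blast
    then show ?thesis using that[of j] j by simp
  qed
qed

text \<open>It suffices to add the generators \<open>n + r j\<close> to \<open>f = i + (len i - 1) * n\<close>, which gives
  \<open>i + r j + len i * n\<close>. If \<open>i + r j\<close> is an Apery element, this lies in \<open>M n\<close> precisely when
  \<open>len (i + r j) \<le> len i\<close>. Otherwise \<open>i + r j - d * n\<close> lies in \<open>S\<close> and has smaller length than
  \<open>i + r j\<close>, hence length at most \<open>len i\<close>, and the sum is in \<open>M n\<close> in any case.\<close>
lemma pseudo_Frobenius_M: "pseudo_Frobenius (M n) = pf_value n ` pf_indices n"
proof (intro set_eqI iffI)
  fix f assume "f \<in> pseudo_Frobenius (M n)"
  then have f: "f \<notin> M n" "\<And>h. h \<in> M n \<Longrightarrow> h \<noteq> 0 \<Longrightarrow> f + h \<in> M n"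
    by (auto simp: pseudo_Frobenius_def)
  obtain i t where it: "i \<in> Apery S D" "f = i + t * n" using apery_representative by blast
  have iS: "i \<in> S" using it by (simp add: Apery_def)
  have gen: "n + r j \<in> M n" if "j \<in> {1..k}" for j
    unfolding shifted_semigroup_iff
    using generator_in_S[OF that] len_le[OF factors_generator[OF that]]
    by (intro exI[of _ "r j"] exI[of _ 1]) simp
  have "n \<in> M n"
    unfolding shifted_semigroup_iff using zero_in_S len_le[OF factors_0]
    by (intro exI[of _ 0] exI[of _ 1]) simp
  then have "f + n \<in> M n" using f n_pos by simp
  then have "i + (t + 1) * n \<in> M n" using it by (simp add: algebra_simps)
  then have "len i \<le> t + 1" using apery_in_M_iff it by blast
  moreover have "t < len i" using f it apery_in_M_iff[of i t] by simp
  ultimately have t: "t = len i - 1" by simp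
  have "len (i + r j) \<le> len i" if j: "j \<in> {1..k}" "i + r j - D \<notin> S" for j
  proof -
    have "i + r j \<in> Apery S D" using j iS S_add generator_in_S by (simp add: Apery_def)
    moreover have "f + (n + r j) \<in> M n" using f gen[OF j(1)] r_bounds[OF j(1)] n_pos by simp
    then have "(i + r j) + len i * n \<in> M n" using it t by (simp add: algebra_simps)
    ultimately show ?thesis using apery_in_M_iff by blast
  qed
  then have "i \<in> pf_indices n" using it by (simp add: pf_indices_def)
  then show "f \<in> pf_value n ` pf_indices n" using it t by (auto simp: pf_value_def)
next
  fix f assume "f \<in> pf_value n ` pf_indices n"
  then obtain i where i: "i \<in> pf_indices n" "f = i + (len i - 1) * n" by (auto simp: pf_value_def)
  have iA: "i \<in> Apery S D" and iS: "i \<in> S" using i by (auto simp: pf_indices_def Apery_def)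
  have gen: "f + (n + r j) \<in> M n" if j: "j \<in> {0..k}" for j
  proof (cases "j = 0")
    case True
    then have "f + (n + r j) = i + len i * n" using i r_0 by (simp add: algebra_simps)
    then show ?thesis using apery_in_M_iff[OF iA] by simp
  next
    case False
    then have j: "j \<in> {1..k}" using j by auto
    have eq: "f + (n + r j) = (i + r j) + len i * n" using i by (simp add: algebra_simps)
    have S: "i + r j \<in> S" using iS j S_add generator_in_S by blast
    show ?thesis
    proof (cases "i + r j - D \<in> S")
      case False
      then have "len (i + r j) \<le> len i" using i j by (simp add: pf_indices_def)
      then show ?thesis unfolding eq shifted_semigroup_iff using S by blast
    next
      case True
      have "len (i + r j - D) < len (i + r j)" using len_less[OF True S] by simp
      also have "\<dots> \<le> len i + 1" using len_add_generator[OF iS j] .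
      finally have "len (i + r j - D) \<le> len i + d" using d_pos by simp
      moreover have "f + (n + r j) = (i + r j - D) + (len i + d) * n"
        unfolding eq by (simp add: algebra_simps)
      ultimately show ?thesis unfolding shifted_semigroup_iff using True by blast
    qed
  qed
  have add: "x + y \<in> M n" if "x \<in> M n" "y \<in> M n" for x y
    using numerical_semigroup_M that by (simp add: numerical_semigroup_def)
  have "f + h \<in> M n" if h: "h \<in> M n" "h \<noteq> 0" for h
  proof -
    obtain j where j: "j \<in> {0..k}" "h - (n + r j) \<in> M n" using peel_generator[OF h] .
    have "(f + (n + r j)) + (h - (n + r j)) \<in> M n" using add gen j by blast
    then show ?thesis by simp
  qed
  moreover have "f \<notin> M n" using apery_in_M_iff[OF iA] i by simp
  ultimately show "f \<in> pseudo_Frobenius (M n)" by (simp add: pseudo_Frobenius_def)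
qed

section \<open>Low and high indices\<close>

text \<open>Below \<open>d * n - R\<close>, the conditions that mention \<open>n\<close> only say that negative numbers are not in
  \<open>S\<close>.\<close>
lemma pf_indices_below_iff:
  assumes "i < D - R"
  shows "i \<in> pf_indices n \<longleftrightarrow> i \<in> low_indices"
proof -
  have "x \<notin> S" if "x < 0" for x using that S_nonneg[of x] by auto
  moreover have "i + r j - D < 0" if "j \<in> {1..k}" for j using r_bounds[OF that] assms by simp
  moreover have "i - D < 0" using assms R_ge_2 by simp
  ultimately show ?thesis by (simp add: pf_indices_def low_indices_def Apery_def)
qed

lemma low_indices_below: "i \<in> low_indices \<Longrightarrow> i < D - R"
  using low_indices_bound D_bounds R_ge_2 by force

lemma high_in_S: "d dvd x \<Longrightarrow> D - R \<le> x \<Longrightarrow> x \<in> S"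
  using notin_S_le_F[of x] D_bounds R_square R_ge_2 by force

lemma len_high_shift:
  assumes "d dvd x" "D - R \<le> x"
  shows "len (x + int lam * d * R) = len x + int lam * d"
proof -
  have "x + int (lam * nat d) * R \<in> S \<and> len (x + int (lam * nat d) * R) = len x + int (lam * nat d)"
    using len_add_mult_R[of x "lam * nat d"] high_in_S[OF assms] assms D_bounds by simp
  then show ?thesis using d_pos by simp
qed

text \<open>From \<open>d * n - R\<close> on, every multiple of \<open>d\<close> lies in \<open>S\<close>, and adding \<open>lam * d * R\<close> increases all
  lengths by the same amount, so their comparison is unaffected.\<close>
lemma pf_indices_high_shift:
  assumes "D - R \<le> i"
  shows "i + int lam * d * R \<in> pf_indices (n + int lam * R) \<longleftrightarrow> i \<in> pf_indices n"
proof (cases "d dvd i")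
  case True
  have nonneg: "0 \<le> int lam * d * R" using d_pos R_ge_2 by simp
  have D: "d * (n + int lam * R) = D + int lam * d * R" by (simp add: algebra_simps)
  have "i \<in> S" "i + int lam * d * R \<in> S" using assms True nonneg by (auto intro!: high_in_S)
  moreover have "len (i + int lam * d * R + r j) \<le> len (i + int lam * d * R)
      \<longleftrightarrow> len (i + r j) \<le> len i" if j: "j \<in> {1..k}" for j
  proof -
    have "len (i + r j + int lam * d * R) = len (i + r j) + int lam * d"
      using assms True d_dvd_r[OF j] r_bounds[OF j] by (intro len_high_shift) auto
    then show ?thesis using len_high_shift[OF True assms, of lam] by (simp add: algebra_simps)
  qed
  ultimately show ?thesis unfolding pf_indices_def Apery_def D by (simp add: algebra_simps)
next
  case False
  then have "i \<notin> S" using d_dvd_S by blast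
  moreover have "\<not> d dvd i + int lam * d * R"
    using False by (metis dvd_add_left_iff dvd_mult2 dvd_triv_right)
  then have "i + int lam * d * R \<notin> S" using d_dvd_S by blast
  ultimately show ?thesis by (simp add: pf_indices_def Apery_def)
qed

lemma pf_indices_bounds:
  assumes "i \<in> pf_indices n"
  shows "d dvd i" "i \<in> S" "i \<le> D + F" "i \<notin> low_indices \<Longrightarrow> D - R \<le> i"
  using assms apery_bounds[of i] pf_indices_below_iff[of i]
  by (auto simp: pf_indices_def Apery_def not_less[symmetric])

section \<open>Persistence of the pairing\<close>

text \<open>Let \<open>i + j = e + q * d * n\<close>. If both \<open>i\<close> and \<open>j\<close> are high, then \<open>q \<ge> 1\<close>, and \<open>e\<close> would be
  longer than its size permits. If both are low, the sizes leave \<open>q = -1\<close>, which contradicts that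
  \<open>e\<close> is an Apery element, and \<open>q = 0\<close>, which contradicts the lengths: adding \<open>R\<close> twice to the high index \<open>e\<close> increases the
  length by 2, whereas adding \<open>R\<close> to \<open>i\<close> and to \<open>j\<close> does not increase theirs. In the mixed case only
  \<open>q = 0\<close> fits the sizes.\<close>
lemma pf_value_pair:
  assumes i: "i \<in> pf_indices n" and j: "j \<in> pf_indices n" and e: "e \<in> pf_indices n"
    and e_high: "e \<notin> low_indices" and sum: "pf_value n i + pf_value n j = pf_value n e"
  shows "i + j = e \<and> len i + len j = len e + 1 \<and> (i \<in> low_indices \<longleftrightarrow> j \<notin> low_indices)"
proof -
  note bi = pf_indices_bounds[OF i] and bj = pf_indices_bounds[OF j] and be = pf_indices_bounds[OF e]
  have eq: "i + j - e = (len e + 1 - len i - len j) * n"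
    using sum by (simp add: pf_value_def algebra_simps)
  then have "n dvd i + j - e" by simp
  moreover have "d dvd i + j - e" using bi bj be by simp
  ultimately have "d * n dvd i + j - e" using coprime_n_d by (simp add: divides_mult coprime_commute)
  then obtain q where "i + j - e = D * q" by (auto elim: dvdE)
  then have q: "i + j - e = q * D" by simp
  then have "(q * d) * n = (len e + 1 - len i - len j) * n" using eq q by (metis mult.assoc)
  then have qlen: "q * d = len e + 1 - len i - len j" using n_pos by (metis less_irrefl mult_right_cancel)
  have e_ge: "D - R \<le> e" using be e_high by blast
  have q_le: "q \<le> a" if "i + j - e < (a + 1) * D" for a
    using mult_right_less_imp_less[of q D "a + 1"] that q D_bounds by linarith
  have q_ge: "a \<le> q" if "(a - 1) * D < i + j - e" for a
    using mult_right_less_imp_less[of "a - 1" D q] that q D_bounds by linarith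
  have not_both_low: False if low: "i \<in> low_indices" "j \<in> low_indices"
  proof -
    note li = low_indices_bound[OF low(1)] and lj = low_indices_bound[OF low(2)]
    have "q \<le> 0" using q_le[of 0] li lj e_ge D_bounds R_ge_2 by simp
    have "F < D" "R * R + F < D" using D_bounds R_square R_ge_2 by linarith+
    then have "- 1 \<le> q" using q_ge[of "- 1"] li lj be(3) by simp
    have "q \<noteq> - 1"
    proof
      assume "q = - 1"
      then have "e - D = i + j" using q by simp
      then have "e - D \<in> S" using S_add bi bj by simp
      then show False using e by (simp add: pf_indices_def Apery_def)
    qed
    then have "q = 0" using \<open>q \<le> 0\<close> \<open>- 1 \<le> q\<close> by simp
    then have e_eq: "e = i + j" and len_eq: "len i + len j = len e + 1" using q qlen by auto
    have k1: "k \<in> {1..k}" using k_ge_2 by simp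
    have "len e + 2 = len (e + int 2 * R)"
      using len_add_mult_R[OF be(2), of 2] e_ge D_bounds by simp
    also have "\<dots> = len ((i + R) + (j + R))" by (simp add: e_eq algebra_simps)
    also have "\<dots> \<le> len (i + R) + len (j + R)"
      using S_add bi(2) bj(2) generator_in_S[OF k1] by (intro len_add) auto
    also have "\<dots> \<le> len i + len j" using low k1 by (intro add_mono) (auto simp: low_indices_def)
    finally show False using len_eq by simp
  qed
  have not_both_high: False if high: "i \<notin> low_indices" "j \<notin> low_indices"
  proof -
    have "D - R \<le> i" "D - R \<le> j" using bi bj high by auto
    then have "1 \<le> q" using q_ge[of 1] be(3) D_bounds R_square R_ge_2 by simp
    then have "1 * d \<le> q * d" "1 * D \<le> q * D" using d_pos D_bounds
      by (blast intro: mult_right_mono less_imp_le)+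
    then have "e + D \<le> i + j" "len i + len j \<le> len e"
      using q qlen d_pos by linarith+
    have "i + j \<le> (len i + len j) * R"
      using le_len_mult_R[OF bi(2)] le_len_mult_R[OF bj(2)] by (simp add: algebra_simps)
    also have "\<dots> \<le> len e * R" using \<open>len i + len j \<le> len e\<close> R_ge_2 by (intro mult_right_mono) auto
    also have "\<dots> \<le> R * R - R + e" by (rule len_mult_R_le[OF be(2)])
    finally show False using \<open>e + D \<le> i + j\<close> D_bounds R_ge_2 by linarith
  qed
  have mixed: "q = 0" if "a \<in> low_indices" "D - R \<le> b" "b \<le> D + F" "a + b = i + j" for a b
  proof -
    note la = low_indices_bound[OF that(1)]
    have "q \<le> 0" using q_le[of 0] la that e_ge D_bounds R_ge_2 by simp
    moreover have "0 \<le> q" using q_ge[of 0] la that be(3) D_bounds R_square R_ge_2 by simp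
    ultimately show ?thesis by simp
  qed
  have "i \<in> low_indices \<longleftrightarrow> j \<notin> low_indices" using not_both_low not_both_high by blast
  moreover have "q = 0"
    using calculation mixed[of i j] mixed[of j i] bi bj by (auto simp: add.commute)
  ultimately show ?thesis using q qlen by simp
qed

text \<open>The element \<open>w = d * n + F\<close> is the largest one in the Apery set of \<open>S\<close>. Its size makes it
  longer than every low index, so that \<open>pf_value n w\<close> is a gap of \<open>M n\<close> exceeding all low
  pseudo-Frobenius numbers.\<close>
lemma Frobenius_high_index:
  assumes short: "\<And>l. l \<in> low_indices \<Longrightarrow> len l * R + 3 * R < D"
  obtains e where "e \<in> pf_indices n" "e \<notin> low_indices" "Frobenius (M n) = pf_value n e"
proof -
  obtain e where e: "e \<in> pf_indices n" "Frobenius (M n) = pf_value n e"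
    using Frobenius_in_pseudo_Frobenius[OF numerical_semigroup_M] pseudo_Frobenius_M by auto
  have "e \<notin> low_indices"
  proof
    assume low: "e \<in> low_indices"
    define w where "w = D + F"
    have w_ge: "D - R \<le> w" using F_ge d_le_R by (simp add: w_def)
    then have wS: "w \<in> S" using high_in_S[of w] d_dvd_F by (simp add: w_def)
    then have "w \<in> Apery S D" using F_notin_S by (simp add: w_def Apery_def)
    then have "pf_value n w \<notin> M n" using apery_in_M_iff by (simp add: pf_value_def)
    then have "pf_value n w \<le> pf_value n e"
      using Frobenius_greatest(2)[OF numerical_semigroup_M] e(2) by metis
    moreover have "len e * R < len w * R"
      using short[OF low] le_len_mult_R[OF wS] w_ge R_ge_2 by linarith
    then have "len e < len w" using R_ge_2 by simp
    then have "(len e - 1) * n < (len w - 1) * n" using n_pos by simp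
    moreover have "e < w" using low_indices_below[OF low] w_ge by simp
    ultimately show False by (simp add: pf_value_def)
  qed
  then show ?thesis using that e by blast
qed

text \<open>The index 0 is excluded, as \<open>len R > len 0\<close>; all other indices have positive length.\<close>
lemma pf_value_nonneg:
  assumes "i \<in> pf_indices n"
  shows "0 \<le> pf_value n i"
proof -
  note b = pf_indices_bounds[OF assms]
  have "i \<noteq> 0"
  proof
    assume "i = 0"
    then have "0 \<in> low_indices" using assms pf_indices_below_iff[of 0] D_bounds R_square R_ge_2 by simp
    then have "len R \<le> len 0" using k_ge_2 by (auto simp: low_indices_def dest!: bspec[of _ _ k])
    then have "len R \<le> 0" using len_le[OF factors_0] by simp
    then have "len R * R \<le> 0" using R_ge_2 by (simp add: mult_le_0_iff)
    moreover have "R \<le> len R * R" using le_len_mult_R generator_in_S[of k] k_ge_2 by simp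
    ultimately show False using R_ge_2 by simp
  qed
  then have "0 < len i" using le_len_mult_R[OF b(2)] S_nonneg[OF b(2)] len_nonneg[of i]
    by (cases "len i = 0") auto
  then show ?thesis using S_nonneg[OF b(2)] n_pos by (simp add: pf_value_def)
qed

text \<open>The map \<open>up\<close> fixes low indices and shifts high ones; it carries the indices for \<open>n\<close> onto those
  for \<open>n'\<close>. Since it preserves the pairing equations of \<open>pf_value_pair\<close>, every pseudo-Frobenius
  number of \<open>M n'\<close> other than the image of the Frobenius number of \<open>M n\<close> has a dual with respect to
  that image. As the duals are nonnegative, the image is the largest pseudo-Frobenius number, that
  is, the Frobenius number of \<open>M n'\<close>.\<close>
lemma almost_symmetric_shift:
  assumes AS: "almost_symmetric (M n)"
    and short: "\<And>l. l \<in> low_indices \<Longrightarrow> len l * R + 3 * R < D"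
  shows "almost_symmetric (M (n + int lam * R))"
proof -
  define n' where "n' = n + int lam * R"
  have "0 \<le> int lam * R" using R_ge_2 by simp
  then have "N0 r k < n'" using n_gt_N0 by (simp add: n'_def)
  moreover have "coprime n' d"
  proof -
    obtain s where "R = d * s" using d_dvd_R by (auto elim: dvdE)
    then have "n' = (int lam * s) * d + n" by (simp add: n'_def mult_ac)
    then show ?thesis using coprime_n_d
      by (simp add: coprime_iff_gcd_eq_1 gcd_add_mult gcd.commute)
  qed
  ultimately interpret shifted: large_shift r k n' by unfold_locales
  define up where "up i = (if i \<in> low_indices then i else i + int lam * d * R)" for i
  have up_low: "up i = i" if "i \<in> low_indices" for i using that by (simp add: up_def)
  have up_high: "up i = i + int lam * d * R \<and> len (up i) = len i + int lam * d"
    if "i \<in> pf_indices n" "i \<notin> low_indices" for i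
    using that pf_indices_bounds[OF that(1)] len_high_shift[of i lam] by (simp add: up_def)
  have up_in: "up i \<in> pf_indices n'" if i: "i \<in> pf_indices n" for i
  proof (cases "i \<in> low_indices")
    case True
    then show ?thesis
      using shifted.pf_indices_below_iff shifted.low_indices_below by (simp add: up_def)
  next
    case False
    then show ?thesis
      using i pf_indices_bounds(4)[OF i] pf_indices_high_shift[of i lam] by (simp add: up_def n'_def)
  qed
  have up_surj: "\<exists>i\<in>pf_indices n. i' = up i" if i': "i' \<in> pf_indices n'" for i'
  proof (cases "i' \<in> low_indices")
    case True
    then show ?thesis using pf_indices_below_iff low_indices_below up_low by metis
  next
    case False
    define i where "i = i' - int lam * d * R"
    have "d * n' - R \<le> i'" using shifted.pf_indices_bounds(4)[OF i' False] .
    then have "D - R \<le> i" by (simp add: i_def n'_def algebra_simps)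
    moreover from this have "i \<in> pf_indices n"
      using pf_indices_high_shift[of i lam] i' by (simp add: i_def n'_def)
    moreover have "i \<notin> low_indices" using low_indices_below calculation(1) by force
    ultimately show ?thesis by (intro bexI[of _ i]) (auto simp: up_def i_def)
  qed
  obtain e where e: "e \<in> pf_indices n" "e \<notin> low_indices" "Frobenius (M n) = pf_value n e"
    using Frobenius_high_index short by metis
  have dual: "\<exists>j\<in>pf_indices n. pf_value n' (up i) + pf_value n' (up j) = pf_value n' (up e)"
    if i: "i \<in> pf_indices n" "i \<noteq> e" for i
  proof -
    have "pf_value n i \<noteq> pf_value n e"
    proof
      assume "pf_value n i = pf_value n e"
      then have "e - i = n * (len i - len e)" by (simp add: pf_value_def algebra_simps)
      then have "i = e" using apery_unique[of i e] i e by (simp add: pf_indices_def)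
      then show False using i by simp
    qed
    then have "pf_value n e - pf_value n i \<in> pf_value n ` pf_indices n"
      using AS i e almost_symmetric_iff_pseudo_Frobenius_dual[OF numerical_semigroup_M]
        pseudo_Frobenius_M by auto
    then obtain j where j: "j \<in> pf_indices n" "pf_value n j = pf_value n e - pf_value n i" by force
    then have *: "i + j = e" "len i + len j = len e + 1" "i \<in> low_indices \<longleftrightarrow> j \<notin> low_indices"
      using pf_value_pair[OF i(1) j(1) e(1,2)] by auto
    \<comment> \<open>Exactly one summand is shifted, and so is \<open>e\<close>.\<close>
    have "up i + up j = up e \<and> len (up i) + len (up j) = len (up e) + 1"
      using * up_low up_high[OF i(1)] up_high[OF j(1)] up_high[OF e(1,2)]
      by (cases "i \<in> low_indices") auto
    then have "pf_value n' (up i) + pf_value n' (up j) = pf_value n' (up e)"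
      by (intro pf_value_add) auto
    then show ?thesis using j by blast
  qed
  have NS: "numerical_semigroup (M n')" by (rule shifted.numerical_semigroup_M)
  have Fro: "Frobenius (M n') = pf_value n' (up e)"
  proof (rule antisym)
    have "pf_value n' (up e) \<in> pseudo_Frobenius (M n')"
      using shifted.pseudo_Frobenius_M up_in[OF e(1)] by simp
    then show "pf_value n' (up e) \<le> Frobenius (M n')"
      using Frobenius_greatest(2)[OF NS] by (simp add: pseudo_Frobenius_def)
    obtain i where i: "i \<in> pf_indices n" "Frobenius (M n') = pf_value n' (up i)"
      using Frobenius_in_pseudo_Frobenius[OF NS] shifted.pseudo_Frobenius_M up_surj by auto
    show "Frobenius (M n') \<le> pf_value n' (up e)"
    proof (cases "i = e")
      case False
      then obtain j where "j \<in> pf_indices n"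
        "pf_value n' (up i) + pf_value n' (up j) = pf_value n' (up e)" using dual i by blast
      then show ?thesis using i(2) shifted.pf_value_nonneg[OF up_in, of j] by simp
    qed (use i in simp)
  qed
  have "Frobenius (M n') - f \<in> pseudo_Frobenius (M n')"
    if f: "f \<in> pseudo_Frobenius (M n')" "f \<noteq> Frobenius (M n')" for f
  proof -
    obtain i where i: "i \<in> pf_indices n" "f = pf_value n' (up i)"
      using f(1) shifted.pseudo_Frobenius_M up_surj by auto
    then have "i \<noteq> e" using f(2) Fro by auto
    then obtain j where j: "j \<in> pf_indices n"
      "pf_value n' (up i) + pf_value n' (up j) = pf_value n' (up e)"
      using dual[OF i(1)] by blast
    then have "Frobenius (M n') - f = pf_value n' (up j)" using i Fro by simp
    then show ?thesis using shifted.pseudo_Frobenius_M up_in[OF j(1)] by simp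
  qed
  then show ?thesis
    using almost_symmetric_iff_pseudo_Frobenius_dual[OF NS] by (simp add: n'_def)
qed

text \<open>Low indices belong to the set over which \<open>N3\<close> takes its maximum, and the division by \<open>d\<close> in
  \<open>N3\<close> is exact because \<open>d\<close> divides \<open>R\<close>.\<close>
lemma low_len_bound:
  assumes "N3 r k n < n" and l: "l \<in> low_indices"
  shows "len l * R + 3 * R < D"
proof -
  have "l \<in> pf_indices n" using pf_indices_below_iff low_indices_below l by blast
  then have "l \<in> Apery S D" "pf_value n l \<in> pseudo_Frobenius (M n)"
    using pseudo_Frobenius_M by (auto simp: pf_indices_def)
  moreover have "[pf_value n l = l] (mod n)"
    by (simp add: pf_value_def cong_iff_dvd_diff)
  ultimately have l': "l \<in> P_set' r k n"
    using low_indices_below[OF l] by (auto simp: P_set'_def P_set_def)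
  have "P_set' r k n \<subseteq> {0..D}"
    using apery_bounds(1) R_ge_2 by (force simp: P_set'_def P_set_def)
  then have "finite (P_set' r k n)" by (rule finite_subset) simp
  moreover have "{(len l * R + 3 * R) div d | l. l \<in> P_set' r k n}
      = (\<lambda>l. (len l * R + 3 * R) div d) ` P_set' r k n" by auto
  ultimately have "(len l * R + 3 * R) div d \<le> N3 r k n"
    unfolding N3_def using l' by (intro Max_ge) auto
  then have "d * ((len l * R + 3 * R) div d) < d * n" using assms(1) d_pos by simp
  moreover have "d dvd len l * R + 3 * R" using d_dvd_R by simp
  ultimately show ?thesis by simp
qed

end

theorem corollary4p1:
  fixes k :: nat and r :: "nat \<Rightarrow> int" and d n :: int
  assumes "k \<ge> 2"
    and "r 0 = 0"
    and "\<And>i. i < k \<Longrightarrow> r i < r (Suc i)"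
    and "d = Gcd (r ` {1..k})"
    and "n > 0"
    and "gcd n d = 1"
    and "n > N0 r k"
    and "n > N_bound r k n"
    and "almost_symmetric (shifted_semigroup r k n)"
  shows "\<forall>lam :: nat. almost_symmetric (shifted_semigroup r k (n + int lam * r k))"
proof -
  interpret large_shift r k n
    using assms by unfold_locales (auto simp: d_of_def coprime_iff_gcd_eq_1)
  have "N3 r k n < n" using assms(8) by (simp add: N_bound_def)
  then show ?thesis using almost_symmetric_shift assms(9) low_len_bound by blast
qed

end
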